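(* Assume that $1\le q<\alpha<p\le\infty$. Then there is a constant $C$ such that $$\|f\|_{q,p,\alpha}\le C\,\|f\|_{\alpha,p}\qquad\text{for all } f\in L_0(X),$$ where $\|\cdot\|_{q,p,\alpha}$ (three indices) is the fractional amalgam norm and $\|\cdot\|_{\alpha,p}$ (two indices) is the Lorentz norm.
   Context: Setting. $(X,d,\mu)$ is a space of homogeneous type: $d$ is a quasi-metric on $X$ (with a constant $\kappa\ge 1$ such that $d(x,y)\le\kappa(d(x,z)+d(z,y))$ for all $x,y,z\in X$), and $\mu$ is a non-negative Borel measure such that, with $B(x,r)=\{y\in X: d(x,y)<r\}$, there is a constant $C$ with $0<\mu(B(x,2r))\le C\mu(B(x,r))<\infty$ for all $x\in X$, $r>0$. It is assumed moreover that all balls $B(x,r)$ are open for the $d$-topology, $(X,d)$ is separable, $\mu(X)=\infty$, and $B(x,R)\setminus B(x,r)\neq\emptyset$ for all $x\in X$ and $0<r<R<\infty$. Notation. $L_0(X)$ is the complex vector space of classes (modulo equality $\mu$-almost everywhere) of $\mu$-measurable complex-valued functions on $X$; $\|\cdot\|_q$ is the usual norm of $L^q(X)=L^q(X,\mu)$; $\chi_E$ is the characteristic function of $E$. For $f\in L_0(X)$ and $r>0$ (convention $1/\infty=0$), $${}_{r}\|f\|_{q,p,\alpha}=\left[\int_X\left(\mu(B(y,r))^{\frac1\alpha-\frac1p-\frac1q}\,\|f\chi_{B(y,r)}\|_q\right)^p d\mu(y)\right]^{1/p}\quad\text{if } p<\infty,$$ $${}_{r}\|f\|_{q,\infty,\alpha}=\sup_{y\in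 X}\mu(B(y,r))^{\frac1\alpha-\frac1q}\,\|f\chi_{B(y,r)}\|_q\quad\text{if } p=\infty,$$ and $\|f\|_{q,p,\alpha}=\sup_{r>0}\ {}_{r}\|f\|_{q,p,\alpha}\in[0,\infty]$. Lorentz norms. For $f\in L_0(X)$ put $\lambda_f(s)=\mu(\{x\in X:|f(x)|>s\})$ for $s>0$, $f_*(t)=\inf\{s>0:\lambda_f(s)\le t\}$ and $f^*(t)=\frac1t\int_0^t f_*(u)\,du$ for $t>0$. Then $$\|f\|_{\alpha,p}=\left[\frac{\alpha}{p}\int_0^\infty\left(t^{1/\alpha}f^*(t)\right)^p\frac{dt}{t}\right]^{1/p}\ \text{ if } p<\infty,\qquad \|f\|_{\alpha,\infty}=\sup_{t>0}t^{1/\alpha}f^*(t).$$ *)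

theory Defs
  imports "HOL-Analysis.Analysis"
begin


definition qball :: "('a \<Rightarrow> 'a \<Rightarrow> real) \<Rightarrow> 'a \<Rightarrow> real \<Rightarrow> 'a set" where
  "qball d x r = {y. d x y < r}"

definition qtopology :: "('a \<Rightarrow> 'a \<Rightarrow> real) \<Rightarrow> 'a topology" where
  "qtopology d = topology (\<lambda>U. \<forall>x\<in>U. \<exists>r>0. qball d x r \<subseteq> U)"

lemma openin_qtopology:
  "openin (qtopology d) U \<longleftrightarrow> (\<forall>x\<in>U. \<exists>r>0. qball d x r \<subseteq> U)"
proof -
  have "istopology (\<lambda>U. \<forall>x\<in>U. \<exists>r>0. qball d x r \<subseteq> U)"
    unfolding istopology_def
  proof (intro conjI allI impI ballI)
    fix S T x
    assume "\<forall>x\<in>S. \<exists>r>0. qball d x r \<subseteq> S" "\<forall>x\<in>T. \<exists>r>0. qball d x r \<subseteq> T" "x \<in> S \<inter> T"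
    then obtain r s where rs: "r > 0" "qball d x r \<subseteq> S" "s > 0" "qball d x s \<subseteq> T"
      by (metis IntE)
    then have "min r s > 0" "qball d x (min r s) \<subseteq> S \<inter> T"
      by (auto simp: qball_def)
    then show "\<exists>r>0. qball d x r \<subseteq> S \<inter> T" by blast
  next
    fix K x
    assume "\<forall>U\<in>K. \<forall>x\<in>U. \<exists>r>0. qball d x r \<subseteq> U" "x \<in> \<Union>K"
    then show "\<exists>r>0. qball d x r \<subseteq> \<Union>K" by (meson UnionE Union_upper subset_trans)
  qed
  then show ?thesis by (simp add: qtopology_def)
qed

lemma topspace_qtopology [simp]: "topspace (qtopology d) = UNIV"
proof -
  have "openin (qtopology d) UNIV"
    unfolding openin_qtopology by (auto intro: exI[of _ 1])
  then show ?thesis using openin_subset by blast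
qed

locale quasi_metric =
  fixes d :: "'a \<Rightarrow> 'a \<Rightarrow> real"
  assumes nonneg: "0 \<le> d x y"
    and zero_iff: "d x y = 0 \<longleftrightarrow> x = y"
    and sym: "d x y = d y x"
    and quasi_triangle: "\<exists>\<kappa>\<ge>1. \<forall>x y z. d x y \<le> \<kappa> * (d x z + d z y)"

locale homogeneous_type_space = quasi_metric d
  for d :: "'a \<Rightarrow> 'a \<Rightarrow> real" +
  fixes M :: "'a measure"
  assumes space_M: "space M = UNIV"
    and sets_M: "sets M = sigma_sets UNIV {U. openin (qtopology d) U}"
    and doubling: "\<exists>C::real. \<forall>x. \<forall>r>0.
          0 < emeasure M (qball d x (2 * r)) \<and>
          emeasure M (qball d x (2 * r)) \<le> ennreal C * emeasure M (qball d x r) \<and>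
          emeasure M (qball d x r) < \<infinity>"
    \<comment> \<open>In a general quasi-metric space balls need not be open; the value of \<open>emeasure\<close> on a
      non-measurable set would be \<open>0\<close>.\<close>
    and openin_qball: "openin (qtopology d) (qball d x r)"
    and separable: "separable_space (qtopology d)"
    and infinite_measure: "emeasure M UNIV = \<infinity>"
    and annulus_nonempty: "0 < r \<Longrightarrow> r < R \<Longrightarrow> qball d x R - qball d x r \<noteq> {}"



text \<open>Powers of extended nonnegative reals, meaningful for exponents \<open>a > 0\<close> only:
  \<open>0\<close> is sent to \<open>0\<close> and \<open>\<infinity>\<close> to \<open>\<infinity>\<close>.\<close>

definition epowr :: "ennreal \<Rightarrow> real \<Rightarrow> ennreal" where
  "epowr x a = (if x = \<infinity> then \<infinity> else ennreal (enn2real x powr a))"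

definition Lq_norm :: "'a measure \<Rightarrow> real \<Rightarrow> ('a \<Rightarrow> complex) \<Rightarrow> ennreal" where
  "Lq_norm M q f = epowr (\<integral>\<^sup>+ x. ennreal (norm (f x) powr q) \<partial>M) (1 / q)"

text \<open>The exponents \<open>q\<close> and \<open>\<alpha>\<close> are finite, \<open>p\<close> may be \<open>\<infinity>\<close>.  All balls have finite positive
  measure, so the (possibly negative) power of the measure of a ball is a real power.\<close>

definition amalgam_norm_at ::
  "('a \<Rightarrow> 'a \<Rightarrow> real) \<Rightarrow> 'a measure \<Rightarrow> real \<Rightarrow> real \<Rightarrow> ereal \<Rightarrow> real \<Rightarrow> ('a \<Rightarrow> complex) \<Rightarrow> ennreal"
where
  "amalgam_norm_at d M r q p \<alpha> f =
    (if p = \<infinity> then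
       (SUP y\<in>space M.
          ennreal (measure M (qball d y r) powr (1 / \<alpha> - 1 / q)) *
          Lq_norm M q (\<lambda>x. f x * indicator (qball d y r) x))
     else
       let p' = real_of_ereal p in
       epowr (\<integral>\<^sup>+ y. epowr
          (ennreal (measure M (qball d y r) powr (1 / \<alpha> - 1 / p' - 1 / q)) *
           Lq_norm M q (\<lambda>x. f x * indicator (qball d y r) x)) p' \<partial>M) (1 / p'))"

definition amalgam_norm ::
  "('a \<Rightarrow> 'a \<Rightarrow> real) \<Rightarrow> 'a measure \<Rightarrow> real \<Rightarrow> ereal \<Rightarrow> real \<Rightarrow> ('a \<Rightarrow> complex) \<Rightarrow> ennreal"
where
  "amalgam_norm d M q p \<alpha> f = (SUP r\<in>{0<..}. amalgam_norm_at d M r q p \<alpha> f)"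

definition distribution_fun :: "'a measure \<Rightarrow> ('a \<Rightarrow> complex) \<Rightarrow> real \<Rightarrow> ennreal" where
  "distribution_fun M f s = emeasure M {x \<in> space M. norm (f x) > s}"

definition rearrangement :: "'a measure \<Rightarrow> ('a \<Rightarrow> complex) \<Rightarrow> real \<Rightarrow> ennreal" where
  "rearrangement M f t = Inf {ennreal s | s. s > 0 \<and> distribution_fun M f s \<le> ennreal t}"

definition maximal_rearrangement :: "'a measure \<Rightarrow> ('a \<Rightarrow> complex) \<Rightarrow> real \<Rightarrow> ennreal" where
  "maximal_rearrangement M f t =
     ennreal (1 / t) * (\<integral>\<^sup>+ u\<in>{0<..<t}. rearrangement M f u \<partial>lborel)"

definition lorentz_norm ::
  "'a measure \<Rightarrow> real \<Rightarrow> ereal \<Rightarrow> ('a \<Rightarrow> complex) \<Rightarrow> ennreal"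
where
  "lorentz_norm M \<alpha> p f =
    (if p = \<infinity> then
       (SUP t\<in>{0<..}. ennreal (t powr (1 / \<alpha>)) * maximal_rearrangement M f t)
     else
       let p' = real_of_ereal p in
       epowr (ennreal (\<alpha> / p') *
         (\<integral>\<^sup>+ t\<in>{0<..}. (epowr (ennreal (t powr (1 / \<alpha>)) * maximal_rearrangement M f t) p' *
            ennreal (1 / t)) \<partial>lborel)) (1 / p'))"

end

theory Submission
  imports Defs
begin

text \<open>
  Fix a radius \<open>r\<close>, write \<open>B\<close> for the ball of centre \<open>y\<close> and radius \<open>r\<close>, \<open>v\<close> for its measure, and
  \<open>E\<^sub>l\<close> for the superlevel set where \<open>norm f > l\<close>.  Since \<open>q < \<alpha>\<close>, the norm of \<open>f\<close> in
  \<open>L\<^sup>q(B)\<close> is controlled by its weak \<open>L\<^sup>\<alpha>\<close> quasi-norm on \<open>B\<close>, at the price of the factor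
  \<open>v\<close> to the power \<open>1/q - 1/\<alpha>\<close> (\<open>nn_integral_powr_le_weak\<close>).  This is exactly the factor that the
  amalgam norm compensates.  If \<open>p = \<infinity>\<close> nothing more is needed, because the Lorentz norm dominates the
  weak norm on the whole space.

  Let \<open>p < \<infinity>\<close> and \<open>a = p / \<alpha> > 1\<close>.  The weak quasi-norm on \<open>B\<close> is at most the local Lorentz
  quantity \<open>A(y) = \<integral> p l\<^bsup>p-1\<^esup> \<mu>(B \<inter> E\<^sub>l)\<^bsup>a\<^esup> dl\<close> to the power \<open>1/p\<close>, and the powers of \<open>v\<close> combine so
  that the integrand of the amalgam norm is at most a constant times \<open>A(y) / v\<close>
  (\<open>scaled_average_le_levels\<close>).  Now \<open>\<mu>(B \<inter> E\<^sub>l)\<^bsup>a\<^esup> \<le> \<mu>(E\<^sub>l)\<^bsup>a-1\<^esup> \<mu>(B \<inter> E\<^sub>l)\<close>, and by Tonelli and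
  doubling \<open>\<integral> \<mu>(B \<inter> E) / v d\<mu>(y) \<le> c \<mu>(E)\<close> for every measurable \<open>E\<close>, with \<open>c\<close> independent of \<open>r\<close>.
  Hence \<open>\<integral> A(y) / v d\<mu>(y) \<le> c \<integral> p l\<^bsup>p-1\<^esup> \<mu>(E\<^sub>l)\<^bsup>a\<^esup> dl\<close> (\<open>averaged_levels_le\<close>).  A last exchange of
  integrals, in the levels \<open>l\<close> and the argument \<open>t\<close> of the rearrangement, bounds the right-hand side by
  the Lorentz norm (\<open>nn_integral_levels_le_lorentz_norm\<close>).

  The set of pairs with \<open>d x y < r\<close> has open sections, but it need not be measurable for the product
  \<open>\<sigma>\<close>-algebra.  Tonelli is therefore applied to a measurable kernel that dominates its indicator
  divided by \<open>v\<close> (\<open>averaging_kernel\<close>).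
\<close>

section \<open>Powers of extended nonnegative reals\<close>

lemma epowr_ennreal: "0 \<le> x \<Longrightarrow> epowr (ennreal x) a = ennreal (x powr a)"
  by (simp add: epowr_def)

lemma epowr_top [simp]: "epowr top a = top"
  by (simp add: epowr_def)

lemma epowr_zero [simp]: "epowr 0 a = 0"
  by (simp add: epowr_def)

lemma epowr_one [simp]: "epowr x 1 = x"
  by (cases x) (auto simp: epowr_ennreal)

lemma epowr_mono:
  assumes "x \<le> y" "0 \<le> a"
  shows "epowr x a \<le> epowr y a"
proof (cases y)
  case (real s)
  then obtain r where "x = ennreal r" "0 \<le> r"
    using assms by (cases x) (auto simp: top_unique)
  with real assms show ?thesis by (simp add: epowr_ennreal powr_mono2)
qed simp

lemma epowr_epowr: "epowr (epowr x a) b = epowr x (a * b)"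
  by (cases x) (simp_all add: epowr_ennreal powr_powr)

lemma epowr_add: "epowr x (a + b) = epowr x a * epowr x b"
  by (cases x) (simp_all add: epowr_ennreal powr_add ennreal_mult')

lemma epowr_cmult:
  assumes "0 \<le> c"
  shows "epowr (ennreal c * x) a = ennreal (c powr a) * epowr x a"
proof (cases x)
  case (real r)
  then show ?thesis
    using assms by (simp add: epowr_ennreal powr_mult flip: ennreal_mult')
next
  case top
  then show ?thesis
    using assms by (cases "c = 0") (simp_all add: ennreal_mult_top)
qed

lemma measurable_epowr [measurable]: "(\<lambda>x. epowr x a) \<in> borel_measurable borel"
  unfolding epowr_def by measurable

lemma nn_integral_powr_real:
  assumes "0 < a" "0 \<le> T"
  shows "(\<integral>\<^sup>+t\<in>{0<..}. ennreal (a * t powr (a - 1)) * indicator {..T} t \<partial>lborel) = ennreal (T powr a)"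
proof -
  have "((\<lambda>t. a * t powr (a - 1)) has_integral a * (T powr (a - 1 + 1) / (a - 1 + 1))) {0..T}"
    by (intro has_integral_mult_right has_integral_powr_from_0) (use assms in auto)
  then have "((\<lambda>t. a * t powr (a - 1)) has_integral T powr a) {0..T}"
    using assms by simp
  from nn_integral_has_integral_lebesgue'[OF _ this]
  have "(\<integral>\<^sup>+t. ennreal (a * t powr (a - 1)) * indicator {0..T} t \<partial>lborel) = ennreal (T powr a)"
    using assms by simp
  moreover have "(\<integral>\<^sup>+t\<in>{0<..}. ennreal (a * t powr (a - 1)) * indicator {..T} t \<partial>lborel)
      = (\<integral>\<^sup>+t. ennreal (a * t powr (a - 1)) * indicator {0..T} t \<partial>lborel)"
    by (intro nn_integral_cong_AE eventually_mono[OF AE_lborel_singleton[of 0]])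
       (auto simp: indicator_def)
  ultimately show ?thesis by simp
qed

text \<open>
  Writing a power as an integral turns \<open>h\<^bsup>q\<^esup>\<close>, \<open>\<mu>(E\<^sub>l)\<^bsup>a\<^esup>\<close> and the power of the rearrangement into
  forms to which Tonelli applies.  For \<open>x = \<infinity>\<close> both sides are infinite.
\<close>

lemma epowr_eq_nn_integral:
  assumes "0 < a"
  shows "(\<integral>\<^sup>+t\<in>{0<..}. ennreal (a * t powr (a - 1)) * indicator {t. ennreal t \<le> x} t \<partial>lborel) = epowr x a"
    (is "?I x = _")
proof (cases x)
  case (real r)
  have "?I x = (\<integral>\<^sup>+t\<in>{0<..}. ennreal (a * t powr (a - 1)) * indicator {..r} t \<partial>lborel)"
    using real by (intro nn_integral_cong) (auto simp: indicator_def)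
  then show ?thesis
    using nn_integral_powr_real[OF assms] real by (simp add: epowr_ennreal)
next
  case top
  have "of_nat n \<le> ?I x" for n
  proof -
    have "of_nat n = ennreal ((real n powr (1 / a)) powr a)"
      using assms by (simp add: powr_powr ennreal_of_nat_eq_real_of_nat)
    also have "\<dots> = (\<integral>\<^sup>+t\<in>{0<..}. ennreal (a * t powr (a - 1)) * indicator {..real n powr (1 / a)} t \<partial>lborel)"
      by (rule nn_integral_powr_real[OF assms, symmetric]) simp
    also have "\<dots> \<le> ?I x"
      using top by (intro nn_integral_mono) (auto simp: indicator_def)
    finally show ?thesis .
  qed
  then have "?I x = top"
    using ennreal_Ex_less_of_nat[of "?I x"] by (force simp: not_le[symmetric] less_top)
  with top show ?thesis by simp
qed

lemma epowr_eq_nn_integral_less: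
  assumes "0 < a"
  shows "(\<integral>\<^sup>+t\<in>{0<..}. ennreal (a * t powr (a - 1)) * indicator {t. ennreal t < x} t \<partial>lborel) = epowr x a"
proof -
  have "AE t in lborel. 0 < t \<longrightarrow> (ennreal t < x \<longleftrightarrow> ennreal t \<le> x)"
    using AE_lborel_singleton[of "enn2real x"] by eventually_elim (auto simp: order.order_iff_strict)
  then have "(\<integral>\<^sup>+t\<in>{0<..}. ennreal (a * t powr (a - 1)) * indicator {t. ennreal t < x} t \<partial>lborel)
    = (\<integral>\<^sup>+t\<in>{0<..}. ennreal (a * t powr (a - 1)) * indicator {t. ennreal t \<le> x} t \<partial>lborel)"
    by (intro nn_integral_cong_AE) (auto elim!: eventually_mono simp: indicator_def)
  then show ?thesis using epowr_eq_nn_integral[OF assms] by simp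
qed

lemma nn_integral_powr_tail:
  assumes "0 < c" "0 < T"
  shows "(\<integral>\<^sup>+t\<in>{T..}. ennreal (t powr (- c - 1)) \<partial>lborel) = ennreal (T powr (- c) / c)"
proof -
  have "((\<lambda>t. t powr (- c - 1)) has_integral - (T powr (- c - 1 + 1)) / (- c - 1 + 1)) {T..}"
    by (rule has_integral_powr_to_inf) (use assms in auto)
  then have "((\<lambda>t. t powr (- c - 1)) has_integral T powr (- c) / c) {T..}"
    by simp
  from nn_integral_has_integral_lebesgue'[OF _ this] show ?thesis by simp
qed

section \<open>Weak type bounds control means on sets of finite measure\<close>

lemma nn_integral_powr_layer_cake:
  assumes "sigma_finite_measure N"
    and [measurable]: "h \<in> borel_measurable N" "B \<in> sets N"
    and "0 < q" "\<And>x. 0 \<le> h x"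
  shows "(\<integral>\<^sup>+x\<in>B. ennreal (h x powr q) \<partial>N)
    = (\<integral>\<^sup>+l\<in>{0<..}. ennreal (q * l powr (q - 1)) * emeasure N {x\<in>B. l < h x} \<partial>lborel)"
proof -
  interpret sigma_finite_measure N by fact
  interpret pair_sigma_finite N lborel ..
  have [simp]: "B \<subseteq> space N" using assms(3) by (rule sets.sets_into_space)
  have "(\<integral>\<^sup>+x\<in>B. ennreal (h x powr q) \<partial>N)
      = (\<integral>\<^sup>+x. (\<integral>\<^sup>+l. ennreal (q * l powr (q - 1)) * indicator {l. l < h x} l * indicator {0<..} l * indicator B x \<partial>lborel) \<partial>N)"
  proof (intro nn_integral_cong)
    fix x
    have "ennreal (h x powr q) = epowr (ennreal (h x)) q"
      using assms by (simp add: epowr_ennreal)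
    also have "\<dots> = (\<integral>\<^sup>+l\<in>{0<..}. ennreal (q * l powr (q - 1)) * indicator {l. ennreal l < ennreal (h x)} l \<partial>lborel)"
      by (rule epowr_eq_nn_integral_less[OF \<open>0 < q\<close>, symmetric])
    also have "\<dots> = (\<integral>\<^sup>+l\<in>{0<..}. ennreal (q * l powr (q - 1)) * indicator {l. l < h x} l \<partial>lborel)"
      by (intro nn_integral_cong) (auto simp: indicator_def ennreal_less_iff)
    finally have "ennreal (h x powr q) = (\<integral>\<^sup>+l\<in>{0<..}. ennreal (q * l powr (q - 1)) * indicator {l. l < h x} l \<partial>lborel)" .
    then show "ennreal (h x powr q) * indicator B x
      = (\<integral>\<^sup>+l. ennreal (q * l powr (q - 1)) * indicator {l. l < h x} l * indicator {0<..} l * indicator B x \<partial>lborel)"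
      by (subst nn_integral_multc) auto
  qed
  also have "\<dots> = (\<integral>\<^sup>+l. (\<integral>\<^sup>+x. ennreal (q * l powr (q - 1)) * indicator {l. l < h x} l * indicator {0<..} l * indicator B x \<partial>N) \<partial>lborel)"
    by (rule Fubini'[symmetric]) measurable
  also have "\<dots> = (\<integral>\<^sup>+l\<in>{0<..}. ennreal (q * l powr (q - 1)) * emeasure N {x\<in>B. l < h x} \<partial>lborel)"
  proof (intro nn_integral_cong)
    fix l
    have "(\<integral>\<^sup>+x. ennreal (q * l powr (q - 1)) * indicator {l. l < h x} l * indicator {0<..} l * indicator B x \<partial>N)
      = (\<integral>\<^sup>+x. ennreal (q * l powr (q - 1)) * indicator {0<..} l * indicator {x\<in>B. l < h x} x \<partial>N)"
      by (intro nn_integral_cong) (auto simp: indicator_def)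
    also have "\<dots> = ennreal (q * l powr (q - 1)) * indicator {0<..} l * emeasure N {x\<in>B. l < h x}"
      by (rule nn_integral_cmult_indicator) measurable
    finally show "(\<integral>\<^sup>+x. ennreal (q * l powr (q - 1)) * indicator {l. l < h x} l * indicator {0<..} l * indicator B x \<partial>N)
      = ennreal (q * l powr (q - 1)) * emeasure N {x\<in>B. l < h x} * indicator {0<..} l"
      by (simp add: ac_simps)
  qed
  finally show ?thesis .
qed

text \<open>
  A weak type \<open>\<alpha>\<close> bound controls every lower power on a set of finite measure.  In the layer cake
  formula the measure of a superlevel set is bounded by \<open>v\<close> at small levels and by the hypothesis at
  large ones; \<open>q > 0\<close> makes the first integral converge and \<open>q < \<alpha>\<close> the second.
\<close>

lemma nn_integral_powr_le_weak:
  assumes "sigma_finite_measure N"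
    and [measurable]: "h \<in> borel_measurable N" "B \<in> sets N"
    and h: "\<And>x. 0 \<le> h x"
    and q: "0 < q" "q < \<alpha>"
    and v: "emeasure N B = ennreal v" "0 < v"
    and W: "0 \<le> W" "\<And>l. 0 < l \<Longrightarrow> emeasure N {x\<in>B. l < h x} \<le> ennreal (W * l powr (- \<alpha>))"
  shows "(\<integral>\<^sup>+x\<in>B. ennreal (h x powr q) \<partial>N)
    \<le> ennreal (\<alpha> / (\<alpha> - q) * v powr (1 - q / \<alpha>) * W powr (q / \<alpha>))"
proof -
  define m where "m l = emeasure N {x\<in>B. l < h x}" for l
  have layer: "(\<integral>\<^sup>+x\<in>B. ennreal (h x powr q) \<partial>N) = (\<integral>\<^sup>+l\<in>{0<..}. ennreal (q * l powr (q - 1)) * m l \<partial>lborel)"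
    unfolding m_def using assms by (intro nn_integral_powr_layer_cake) auto
  show ?thesis
  proof (cases "W = 0")
    case True
    have "(\<integral>\<^sup>+l\<in>{0<..}. ennreal (q * l powr (q - 1)) * m l \<partial>lborel) = (\<integral>\<^sup>+l. 0 \<partial>(lborel :: real measure))"
      using W(2) True by (intro nn_integral_cong) (auto simp: indicator_def m_def)
    with layer show ?thesis by simp
  next
    case False
    with W have "0 < W" by simp
    \<comment> \<open>The level at which the two bounds \<open>v\<close> and \<open>W * l powr (- \<alpha>)\<close> agree.\<close>
    define T where "T = (W / v) powr (1 / \<alpha>)"
    have "0 < T" using \<open>0 < W\<close> v by (simp add: T_def)
    have mv: "m l \<le> ennreal v" for l
      unfolding m_def v(1)[symmetric] by (intro emeasure_mono) auto
    have "(\<integral>\<^sup>+l\<in>{0<..}. ennreal (q * l powr (q - 1)) * m l \<partial>lborel)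
      \<le> (\<integral>\<^sup>+l. ennreal v * (ennreal (q * l powr (q - 1)) * indicator {..T} l * indicator {0<..} l)
           + ennreal (q * W) * (ennreal (l powr (- (\<alpha> - q) - 1)) * indicator {T..} l) \<partial>lborel)"
    proof (intro nn_integral_mono)
      fix l :: real
      consider "l \<le> 0" | "0 < l" "l \<le> T" | "T < l" "0 < l" using \<open>0 < T\<close> by linarith
      then show "ennreal (q * l powr (q - 1)) * m l * indicator {0<..} l
        \<le> ennreal v * (ennreal (q * l powr (q - 1)) * indicator {..T} l * indicator {0<..} l)
           + ennreal (q * W) * (ennreal (l powr (- (\<alpha> - q) - 1)) * indicator {T..} l)"
      proof cases
        case 2
        have "ennreal (q * l powr (q - 1)) * m l \<le> ennreal v * ennreal (q * l powr (q - 1))"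
          using mult_left_mono[OF mv[of l], of "ennreal (q * l powr (q - 1))"] by (simp add: mult.commute)
        also have "\<dots> \<le> ennreal v * ennreal (q * l powr (q - 1)) + ennreal (q * W) * (ennreal (l powr (- (\<alpha> - q) - 1)) * indicator {T..} l)"
          by simp
        finally show ?thesis using 2 by (simp add: indicator_def)
      next
        case 3
        have "ennreal (q * l powr (q - 1)) * m l \<le> ennreal (q * l powr (q - 1)) * ennreal (W * l powr (- \<alpha>))"
          using W(2)[OF 3(2)] unfolding m_def by (rule mult_left_mono) simp
        also have "\<dots> = ennreal (q * W * (l powr (q - 1) * l powr (- \<alpha>)))"
          using q W by (simp add: mult_ac flip: ennreal_mult)
        also have "l powr (q - 1) * l powr (- \<alpha>) = l powr (- (\<alpha> - q) - 1)"
          by (simp add: algebra_simps flip: powr_add)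
        finally show ?thesis using 3 q W by (simp add: ennreal_mult)
      qed simp
    qed
    also have "\<dots> = ennreal v * ennreal (T powr q) + ennreal (q * W) * ennreal (T powr (- (\<alpha> - q)) / (\<alpha> - q))"
      using nn_integral_powr_real[OF q(1), of T] nn_integral_powr_tail[of "\<alpha> - q" T] \<open>0 < T\<close> q
      by (subst nn_integral_add) (simp_all add: nn_integral_cmult)
    also have "\<dots> = ennreal (v * T powr q + q * (W * T powr (- (\<alpha> - q))) / (\<alpha> - q))"
      using q v W by (simp add: mult_ac flip: ennreal_mult ennreal_plus)
    also have "v * T powr q = v powr (1 - q / \<alpha>) * W powr (q / \<alpha>)"
      using v \<open>0 < W\<close> by (simp add: T_def powr_powr powr_divide powr_diff)
    also have "W * T powr (- (\<alpha> - q)) = v powr (1 - q / \<alpha>) * W powr (q / \<alpha>)"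
    proof -
      have "T powr (- (\<alpha> - q)) = (W / v) powr (q / \<alpha> - 1)"
        using q by (simp add: T_def powr_powr field_simps)
      also have "W * \<dots> = v powr (1 - q / \<alpha>) * W powr (q / \<alpha>)"
        using v \<open>0 < W\<close> by (simp add: powr_divide powr_diff field_simps)
      finally show ?thesis .
    qed
    also have "v powr (1 - q / \<alpha>) * W powr (q / \<alpha>) + q * (v powr (1 - q / \<alpha>) * W powr (q / \<alpha>)) / (\<alpha> - q)
       = \<alpha> / (\<alpha> - q) * v powr (1 - q / \<alpha>) * W powr (q / \<alpha>)"
      using q by (simp add: field_simps)
    finally show ?thesis using layer by simp
  qed
qed

text \<open>
  The power of \<open>v\<close> on the left is the normalisation in the amalgam norm.  It cancels the dependence on
  the size of \<open>B\<close>, so the bound is the same for all balls.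
\<close>

lemma scaled_average_le_weak:
  assumes "sigma_finite_measure N"
    and "h \<in> borel_measurable N" "B \<in> sets N" "\<And>x. 0 \<le> h x"
    and q: "0 < q" "q < \<alpha>"
    and v: "emeasure N B = ennreal v" "0 < v"
    and W: "0 \<le> W" "\<And>l. 0 < l \<Longrightarrow> emeasure N {x\<in>B. l < h x} \<le> ennreal (W * l powr (- \<alpha>))"
  shows "ennreal (v powr (1 / \<alpha> - 1 / q)) * epowr (\<integral>\<^sup>+x\<in>B. ennreal (h x powr q) \<partial>N) (1 / q)
    \<le> ennreal ((\<alpha> / (\<alpha> - q)) powr (1 / q) * W powr (1 / \<alpha>))"
proof -
  have "epowr (\<integral>\<^sup>+x\<in>B. ennreal (h x powr q) \<partial>N) (1 / q)
    \<le> epowr (ennreal (\<alpha> / (\<alpha> - q) * v powr (1 - q / \<alpha>) * W powr (q / \<alpha>))) (1 / q)"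
    using nn_integral_powr_le_weak[OF assms] q by (intro epowr_mono) auto
  also have "\<dots> = ennreal ((\<alpha> / (\<alpha> - q)) powr (1 / q) * v powr (1 / q - 1 / \<alpha>) * W powr (1 / \<alpha>))"
  proof -
    define b where "b = \<alpha> / (\<alpha> - q)"
    have "0 \<le> b" using q by (simp add: b_def)
    then show ?thesis
      unfolding b_def[symmetric] using q v W
      by (simp add: epowr_ennreal powr_mult powr_powr diff_divide_distrib)
  qed
  finally have "ennreal (v powr (1 / \<alpha> - 1 / q)) * epowr (\<integral>\<^sup>+x\<in>B. ennreal (h x powr q) \<partial>N) (1 / q)
    \<le> ennreal (v powr (1 / \<alpha> - 1 / q)) *
      ennreal ((\<alpha> / (\<alpha> - q)) powr (1 / q) * v powr (1 / q - 1 / \<alpha>) * W powr (1 / \<alpha>))"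
    by (rule mult_left_mono) simp
  also have "\<dots> = ennreal ((v powr (1 / \<alpha> - 1 / q) * v powr (1 / q - 1 / \<alpha>)) * ((\<alpha> / (\<alpha> - q)) powr (1 / q) * W powr (1 / \<alpha>)))"
    by (simp add: mult_ac flip: ennreal_mult)
  also have "v powr (1 / \<alpha> - 1 / q) * v powr (1 / q - 1 / \<alpha>) = 1"
    using v by (simp flip: powr_add)
  finally show ?thesis by simp
qed

text \<open>
  The integral on the right is the \<open>p\<close>-th power of a Lorentz quasi-norm of \<open>h\<close> on \<open>B\<close>.  Its
  integrand contains the nonincreasing factor \<open>N{x \<in> B. t < h x}\<^bsup>p/\<alpha>\<^esup>\<close>, so integrating only up to
  \<open>t = l\<close> bounds \<open>l\<^bsup>p\<^esup> N{x \<in> B. l < h x}\<^bsup>p/\<alpha>\<^esup>\<close> by this quantity, which is a weak type \<open>\<alpha>\<close> bound.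
\<close>

lemma scaled_average_le_levels:
  assumes "sigma_finite_measure N"
    and [measurable]: "h \<in> borel_measurable N" "B \<in> sets N"
    and h: "\<And>x. 0 \<le> h x"
    and q: "0 < q" "q < \<alpha>" and "0 < p"
    and v: "emeasure N B = ennreal v" "0 < v"
  shows "epowr (ennreal (v powr (1 / \<alpha> - 1 / p - 1 / q)) * epowr (\<integral>\<^sup>+x\<in>B. ennreal (h x powr q) \<partial>N) (1 / q)) p
    \<le> ennreal ((\<alpha> / (\<alpha> - q)) powr (p / q)) * (ennreal (1 / v) *
       (\<integral>\<^sup>+l\<in>{0<..}. ennreal (p * l powr (p - 1)) * epowr (emeasure N {x\<in>B. l < h x}) (p / \<alpha>) \<partial>lborel))"
    (is "?lhs \<le> _ * (_ * ?A)")
proof (cases ?A)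
  case top
  then show ?thesis using q v by (simp add: ennreal_mult_top)
next
  case (real A)
  define m where "m l = emeasure N {x\<in>B. l < h x}" for l
  have m_mono: "m l \<le> m t" if "t \<le> l" for t l
    unfolding m_def using that by (intro emeasure_mono) auto
  have weak: "m l \<le> ennreal (A powr (\<alpha> / p) * l powr (- \<alpha>))" if "0 < l" for l
  proof -
    have "m l \<le> ennreal v" unfolding m_def v(1)[symmetric] by (intro emeasure_mono) auto
    then obtain s where s: "m l = ennreal s" "0 \<le> s" by (cases "m l") (auto simp: top_unique)
    have "epowr (m l) (p / \<alpha>) * ennreal (l powr p)
      = epowr (m l) (p / \<alpha>) * (\<integral>\<^sup>+t\<in>{0<..}. ennreal (p * t powr (p - 1)) * indicator {..l} t \<partial>lborel)"
      using \<open>0 < p\<close> that by (simp add: nn_integral_powr_real)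
    also have "\<dots> = (\<integral>\<^sup>+t. epowr (m l) (p / \<alpha>) * (ennreal (p * t powr (p - 1)) * indicator {..l} t * indicator {0<..} t) \<partial>lborel)"
      by (rule nn_integral_cmult[symmetric]) measurable
    also have "\<dots> \<le> ?A"
      unfolding m_def[symmetric] using m_mono q \<open>0 < p\<close>
      by (intro nn_integral_mono) (auto simp: indicator_def mult.commute intro!: mult_right_mono epowr_mono m_mono)
    finally have "s powr (p / \<alpha>) * l powr p \<le> A"
      using s real by (simp add: epowr_ennreal flip: ennreal_mult)
    then have "(s powr (p / \<alpha>) * l powr p) powr (\<alpha> / p) \<le> A powr (\<alpha> / p)"
      using q \<open>0 < p\<close> by (intro powr_mono2) auto
    then have "s * l powr \<alpha> \<le> A powr (\<alpha> / p)"
      using q \<open>0 < p\<close> s that by (simp add: powr_mult powr_powr)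
    then show ?thesis
      using s that by (auto intro!: ennreal_leI simp: powr_minus field_simps)
  qed
  have "?lhs = epowr (ennreal (v powr (- 1 / p)) * (ennreal (v powr (1 / \<alpha> - 1 / q)) * epowr (\<integral>\<^sup>+x\<in>B. ennreal (h x powr q) \<partial>N) (1 / q))) p"
  proof -
    have "v powr (1 / \<alpha> - 1 / p - 1 / q) = v powr (- 1 / p) * v powr (1 / \<alpha> - 1 / q)"
      by (simp add: algebra_simps flip: powr_add)
    then show ?thesis by (simp add: ennreal_mult mult.assoc)
  qed
  also have "\<dots> \<le> epowr (ennreal (v powr (- 1 / p)) * ennreal ((\<alpha> / (\<alpha> - q)) powr (1 / q) * (A powr (\<alpha> / p)) powr (1 / \<alpha>))) p"
    using assms weak unfolding m_def
    by (intro epowr_mono mult_left_mono scaled_average_le_weak) auto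
  also have "\<dots> = ennreal ((\<alpha> / (\<alpha> - q)) powr (p / q)) * (ennreal (1 / v) * ?A)"
  proof -
    define b where "b = \<alpha> / (\<alpha> - q)"
    have "0 \<le> b" using q by (simp add: b_def)
    then have "(v powr (- 1 / p) * (b powr (1 / q) * (A powr (\<alpha> / p)) powr (1 / \<alpha>))) powr p = b powr (p / q) * (1 / v * A)"
      using q v \<open>0 < p\<close> real by (simp add: powr_mult powr_powr powr_minus_divide powr_divide)
    then show ?thesis
      unfolding b_def[symmetric] using v real
      by (simp add: epowr_ennreal flip: ennreal_mult)
  qed
  finally show ?thesis .
qed

section \<open>Rearrangements and Lorentz norms\<close>

lemma borel_measurable_antimono_ennreal:
  fixes g :: "real \<Rightarrow> ennreal"
  assumes "antimono g"
  shows "g \<in> borel_measurable borel"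
proof (rule borel_measurableI_greater)
  fix y
  have "is_interval {x. y < g x}"
    using assms unfolding is_interval_1 by (auto dest: antimonoD intro: less_le_trans)
  then show "{x \<in> space borel. y < g x} \<in> sets borel"
    by (simp add: real_interval_borel_measurable)
qed

lemma measurable_distribution_fun:
  assumes [measurable]: "f \<in> borel_measurable M"
  shows "distribution_fun M f \<in> borel_measurable borel"
  unfolding distribution_fun_def
  by (intro borel_measurable_antimono_ennreal antimonoI emeasure_mono) auto

lemma ennreal_le_rearrangement:
  assumes [measurable]: "f \<in> borel_measurable M"
    and t: "ennreal t < distribution_fun M f l"
  shows "ennreal l \<le> rearrangement M f t"
  unfolding rearrangement_def
proof (rule Inf_greatest, clarify)
  fix s :: real
  assume s: "0 < s" "distribution_fun M f s \<le> ennreal t"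
  show "ennreal l \<le> ennreal s"
  proof (rule ennreal_leI, rule ccontr)
    assume "\<not> l \<le> s"
    then have "distribution_fun M f l \<le> distribution_fun M f s"
      unfolding distribution_fun_def by (intro emeasure_mono) auto
    with s t show False by (meson leD order_trans)
  qed
qed

lemma rearrangement_antimono:
  assumes "u \<le> t"
  shows "rearrangement M f t \<le> rearrangement M f u"
  unfolding rearrangement_def
  by (rule Inf_superset_mono) (use assms in \<open>blast intro: order_trans ennreal_leI\<close>)

lemma measurable_maximal_rearrangement [measurable]:
  "maximal_rearrangement M f \<in> borel_measurable borel"
proof -
  have [measurable]: "rearrangement M f \<in> borel_measurable borel"
    by (intro borel_measurable_antimono_ennreal antimonoI rearrangement_antimono)
  show ?thesis
    unfolding maximal_rearrangement_def greaterThanLessThan_def greaterThan_def lessThan_def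
    by measurable
qed

lemma rearrangement_le_maximal_rearrangement:
  assumes "0 < t"
  shows "rearrangement M f t \<le> maximal_rearrangement M f t"
proof -
  have "rearrangement M f t = ennreal (1 / t) * (rearrangement M f t * ennreal t)"
    using assms by (simp add: mult.left_commute flip: ennreal_mult)
  also have "\<dots> = ennreal (1 / t) * (\<integral>\<^sup>+u\<in>{0<..<t}. rearrangement M f t \<partial>lborel)"
    using assms by (subst nn_integral_cmult_indicator) auto
  also have "\<dots> \<le> maximal_rearrangement M f t"
    unfolding maximal_rearrangement_def
    by (intro mult_left_mono nn_integral_mono) (auto simp: indicator_def intro!: rearrangement_antimono)
  finally show ?thesis .
qed

lemma ennreal_le_maximal_rearrangement:
  assumes "f \<in> borel_measurable M" "0 < t" "ennreal t < distribution_fun M f l"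
  shows "ennreal l \<le> maximal_rearrangement M f t"
  using ennreal_le_rearrangement[OF assms(1,3)] rearrangement_le_maximal_rearrangement[OF assms(2)]
  by (rule order_trans)

text \<open>
  Expand the power of the distribution function as an integral over \<open>t < \<mu>(E\<^sub>l)\<close>.  For such \<open>t\<close> the
  level \<open>l\<close> is at most the rearrangement at \<open>t\<close>, hence at most its mean over \<open>(0, t)\<close>; so after
  exchanging the integrals the inner one runs over levels below that mean.
\<close>

lemma nn_integral_levels_le_maximal_rearrangement:
  assumes f [measurable]: "f \<in> borel_measurable M" and "0 < a" "0 < p"
  shows "(\<integral>\<^sup>+l\<in>{0<..}. ennreal (p * l powr (p - 1)) * epowr (distribution_fun M f l) a \<partial>lborel)
    \<le> (\<integral>\<^sup>+t\<in>{0<..}. ennreal (a * t powr (a - 1)) * epowr (maximal_rearrangement M f t) p \<partial>lborel)"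
proof -
  note [measurable] = measurable_distribution_fun[OF f]
  let ?D = "distribution_fun M f" and ?R = "maximal_rearrangement M f"
  have "(\<integral>\<^sup>+l\<in>{0<..}. ennreal (p * l powr (p - 1)) * epowr (?D l) a \<partial>lborel)
    = (\<integral>\<^sup>+l. \<integral>\<^sup>+t. ennreal (p * l powr (p - 1)) * indicator {0<..} l *
         (ennreal (a * t powr (a - 1)) * indicator {t. ennreal t < ?D l} t * indicator {0<..} t) \<partial>lborel \<partial>lborel)"
    by (subst nn_integral_cmult, measurable) (simp only: epowr_eq_nn_integral_less[OF \<open>0 < a\<close>], simp only: mult_ac)
  also have "\<dots> = (\<integral>\<^sup>+t. \<integral>\<^sup>+l. ennreal (p * l powr (p - 1)) * indicator {0<..} l *
         (ennreal (a * t powr (a - 1)) * indicator {t. ennreal t < ?D l} t * indicator {0<..} t) \<partial>lborel \<partial>lborel)"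
    by (rule lborel_pair.Fubini'[symmetric]) measurable
  also have "\<dots> \<le> (\<integral>\<^sup>+t. \<integral>\<^sup>+l. ennreal (a * t powr (a - 1)) * indicator {0<..} t *
         (ennreal (p * l powr (p - 1)) * indicator {l. ennreal l \<le> ?R t} l * indicator {0<..} l) \<partial>lborel \<partial>lborel)"
    using ennreal_le_maximal_rearrangement[OF f]
    by (intro nn_integral_mono) (auto simp: indicator_def mult_ac)
  also have "\<dots> = (\<integral>\<^sup>+t\<in>{0<..}. ennreal (a * t powr (a - 1)) * epowr (?R t) p \<partial>lborel)"
    by (subst nn_integral_cmult, measurable) (simp only: epowr_eq_nn_integral[OF \<open>0 < p\<close>], simp only: mult_ac)
  finally show ?thesis .
qed

lemma nn_integral_levels_le_lorentz_norm:
  assumes f: "f \<in> borel_measurable M" and "0 < \<alpha>" "0 < p"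
  shows "(\<integral>\<^sup>+l\<in>{0<..}. ennreal (p * l powr (p - 1)) * epowr (distribution_fun M f l) (p / \<alpha>) \<partial>lborel)
    \<le> ennreal ((p / \<alpha>)\<^sup>2) * epowr (lorentz_norm M \<alpha> (ereal p) f) p"
proof -
  define L where "L = (\<integral>\<^sup>+t\<in>{0<..}. (epowr (ennreal (t powr (1 / \<alpha>)) * maximal_rearrangement M f t) p *
            ennreal (1 / t)) \<partial>lborel)"
  have "(\<integral>\<^sup>+t\<in>{0<..}. ennreal (p / \<alpha> * t powr (p / \<alpha> - 1)) * epowr (maximal_rearrangement M f t) p \<partial>lborel)
    = (\<integral>\<^sup>+t. ennreal (p / \<alpha>) * ((epowr (ennreal (t powr (1 / \<alpha>)) * maximal_rearrangement M f t) p *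
            ennreal (1 / t)) * indicator {0<..} t) \<partial>lborel)"
  proof (intro nn_integral_cong)
    fix t :: real
    have "ennreal (p / \<alpha> * t powr (p / \<alpha> - 1)) = ennreal (p / \<alpha>) * (ennreal (t powr (p / \<alpha>)) * ennreal (1 / t))" if "0 < t"
      using that assms by (simp add: powr_diff flip: ennreal_mult)
    moreover have "epowr (ennreal (t powr (1 / \<alpha>)) * maximal_rearrangement M f t) p
      = ennreal (t powr (p / \<alpha>)) * epowr (maximal_rearrangement M f t) p"
      by (simp add: epowr_cmult powr_powr)
    ultimately show "ennreal (p / \<alpha> * t powr (p / \<alpha> - 1)) * epowr (maximal_rearrangement M f t) p * indicator {0<..} t
      = ennreal (p / \<alpha>) * ((epowr (ennreal (t powr (1 / \<alpha>)) * maximal_rearrangement M f t) p *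
            ennreal (1 / t)) * indicator {0<..} t)"
      by (cases "0 < t") (simp_all add: mult_ac)
  qed
  also have "\<dots> = ennreal (p / \<alpha>) * L"
    unfolding L_def by (rule nn_integral_cmult) measurable
  also have "ennreal (p / \<alpha>) = ennreal ((p / \<alpha>)\<^sup>2) * ennreal (\<alpha> / p)"
    using assms by (simp add: power2_eq_square flip: ennreal_mult)
  also have "ennreal ((p / \<alpha>)\<^sup>2) * ennreal (\<alpha> / p) * L
    = ennreal ((p / \<alpha>)\<^sup>2) * epowr (lorentz_norm M \<alpha> (ereal p) f) p"
    using assms by (simp add: lorentz_norm_def L_def epowr_epowr mult.assoc)
  finally show ?thesis
    using nn_integral_levels_le_maximal_rearrangement[OF f, of "p / \<alpha>" p] assms by simp
qed

text \<open>
  The case \<open>p = \<infinity>\<close> of the comparison with levels: any \<open>t\<close> below the measure of the superlevel set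
  satisfies \<open>t\<^bsup>1/\<alpha>\<^esup> l \<le> S\<close>, because the mean rearrangement at \<open>t\<close> is at least \<open>l\<close>.
\<close>

lemma distribution_fun_le_lorentz_norm_infinity:
  assumes f: "f \<in> borel_measurable M" and "0 < \<alpha>" "0 < l"
    and S: "lorentz_norm M \<alpha> \<infinity> f = ennreal S" "0 \<le> S"
  shows "distribution_fun M f l \<le> ennreal (S powr \<alpha> * l powr (- \<alpha>))"
proof (rule ccontr)
  assume "\<not> ?thesis"
  then have "ennreal (S powr \<alpha> * l powr (- \<alpha>)) < distribution_fun M f l" by simp
  then obtain z where z: "ennreal (S powr \<alpha> * l powr (- \<alpha>)) < z" "z < distribution_fun M f l"
    using dense by blast
  then obtain t where t: "z = ennreal t" "0 \<le> t" by (cases z) auto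
  with z have *: "S powr \<alpha> * l powr (- \<alpha>) < t" by (simp add: ennreal_less_iff)
  then have "0 < t" using S by (smt (verit) mult_nonneg_nonneg powr_ge_zero)
  have "ennreal l \<le> maximal_rearrangement M f t"
    using z t \<open>0 < t\<close> by (intro ennreal_le_maximal_rearrangement[OF f]) auto
  then have "ennreal (t powr (1 / \<alpha>)) * ennreal l \<le> ennreal (t powr (1 / \<alpha>)) * maximal_rearrangement M f t"
    by (rule mult_left_mono) simp
  also have "\<dots> \<le> ennreal S"
    unfolding S(1)[symmetric] lorentz_norm_def using \<open>0 < t\<close> by (auto intro!: SUP_upper)
  finally have "t powr (1 / \<alpha>) * l \<le> S"
    using S \<open>0 < l\<close> by (simp flip: ennreal_mult)
  then have "(t powr (1 / \<alpha>) * l) powr \<alpha> \<le> S powr \<alpha>"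
    using assms by (intro powr_mono2) auto
  then have "t * l powr \<alpha> \<le> S powr \<alpha>"
    using assms \<open>0 < t\<close> by (simp add: powr_mult powr_powr)
  with * \<open>0 < l\<close> show False by (simp add: powr_minus field_simps)
qed

section \<open>An averaging kernel on spaces of homogeneous type\<close>

lemma (in homogeneous_type_space) sets_qball [measurable]: "qball d x r \<in> sets M"
  unfolding sets_M using openin_qball by blast

lemma (in homogeneous_type_space) emeasure_qball_pos: "0 < r \<Longrightarrow> 0 < emeasure M (qball d x r)"
  using doubling by (metis half_gt_zero_iff mult_2 field_sum_of_halves)

lemma (in homogeneous_type_space) emeasure_qball_finite: "0 < r \<Longrightarrow> emeasure M (qball d x r) < top"
  using doubling by auto

lemma (in homogeneous_type_space) measure_qball_pos: "0 < r \<Longrightarrow> 0 < measure M (qball d x r)"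
  using emeasure_qball_pos emeasure_qball_finite by (simp add: measure_def enn2real_positive_iff)

lemma (in homogeneous_type_space) emeasure_qball: "0 < r \<Longrightarrow> emeasure M (qball d x r) = ennreal (measure M (qball d x r))"
  using emeasure_qball_finite[of r x] by (intro emeasure_eq_ennreal_measure) auto

lemma (in homogeneous_type_space) doubling_iterated:
  "\<exists>C>0::real. \<forall>n x r. 0 < r \<longrightarrow>
     emeasure M (qball d x (2 ^ n * r)) \<le> ennreal (C ^ n) * emeasure M (qball d x r)"
proof -
  obtain C where C: "\<And>x r. 0 < r \<Longrightarrow> emeasure M (qball d x (2 * r)) \<le> ennreal C * emeasure M (qball d x r)"
    using doubling by blast
  have C': "emeasure M (qball d x (2 * r)) \<le> ennreal (max 1 C) * emeasure M (qball d x r)" if "0 < r" for x r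
    using C[OF that] by (rule order_trans) (intro mult_right_mono ennreal_leI, auto)
  have "emeasure M (qball d x (2 ^ n * r)) \<le> ennreal (max 1 C ^ n) * emeasure M (qball d x r)" if "0 < r" for n x r
  proof (induction n)
    case (Suc n)
    have "emeasure M (qball d x (2 ^ Suc n * r)) \<le> ennreal (max 1 C) * emeasure M (qball d x (2 ^ n * r))"
      using C'[of "2 ^ n * r" x] that by (simp add: mult.assoc)
    also have "\<dots> \<le> ennreal (max 1 C) * (ennreal (max 1 C ^ n) * emeasure M (qball d x r))"
      by (intro mult_left_mono Suc) simp
    finally show ?case by (simp add: ennreal_mult mult.assoc)
  qed simp
  then show ?thesis by (intro exI[of _ "max 1 C"]) auto
qed

lemma (in homogeneous_type_space) sigma_finite: "sigma_finite_measure M"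
proof
  fix x :: 'a
  have "y \<in> (\<Union>n. qball d x (real (Suc n)))" for y
  proof -
    obtain n where "d x y < real n" using reals_Archimedean2 by blast
    then have "y \<in> qball d x (real (Suc n))" by (simp add: qball_def)
    then show ?thesis by blast
  qed
  then have "\<Union> (range (\<lambda>n. qball d x (real (Suc n)))) = space M"
    unfolding space_M by blast
  then show "\<exists>A. countable A \<and> A \<subseteq> sets M \<and> \<Union> A = space M \<and> (\<forall>a\<in>A. emeasure M a \<noteq> \<infinity>)"
    using emeasure_qball_finite
    by (intro exI[of _ "range (\<lambda>n. qball d x (real (Suc n)))"]) (auto simp: less_top)
qed

text \<open>
  By doubling, \<open>v(y) = \<mu>(B(y,r))\<close> is comparable to \<open>\<mu>(B(x,r))\<close> for \<open>d y x < r\<close>, so the mass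
  \<open>\<integral> [d y x < r] / v(y) d\<mu>(y)\<close> is bounded uniformly in \<open>x\<close> and \<open>r\<close>.  The set of pairs at distance
  less than \<open>r\<close> may fail to be product measurable.  It is replaced by a countable union \<open>K\<close> of
  squares of balls centred in a dense set, which contains it and lies within a fixed multiple of the
  radius, and \<open>v(y)\<close> is replaced by the measure of the section of \<open>K\<close> at \<open>x\<close>, which
  doubling bounds by \<open>c v(y)\<close>.  With that weight the kernel integrates exactly to \<open>c\<close>.
\<close>

lemma (in homogeneous_type_space) averaging_kernel:
  "\<exists>c>0::real. \<forall>r>0. \<exists>k. case_prod k \<in> borel_measurable (M \<Otimes>\<^sub>M M) \<and>
     (\<forall>y x. d y x < r \<longrightarrow> ennreal (1 / measure M (qball d y r)) \<le> k y x) \<and>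
     (\<forall>x. (\<integral>\<^sup>+y. k y x \<partial>M) \<le> ennreal c)"
proof -
  interpret sigma_finite_measure M by (rule sigma_finite)
  interpret pair_sigma_finite M M ..
  obtain \<kappa> where \<kappa>: "1 \<le> \<kappa>" "\<And>x y z. d x y \<le> \<kappa> * (d x z + d z y)"
    using quasi_triangle by blast
  obtain C where C: "0 < C" "\<And>n x r. 0 < r \<Longrightarrow>
     emeasure M (qball d x (2 ^ n * r)) \<le> ennreal (C ^ n) * emeasure M (qball d x r)"
    using doubling_iterated by blast
  obtain D where D: "countable D" "qtopology d closure_of D = UNIV"
    using separable unfolding separable_space_def by auto
  have dense: "\<exists>z\<in>D. d y z < r" if "0 < r" for y r
  proof -
    have "y \<in> qball d y r"
      using that zero_iff[of y y] by (simp add: qball_def)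
    moreover have "y \<in> qtopology d closure_of D" using D by simp
    ultimately show ?thesis
      using openin_qball[of y r] unfolding in_closure_of by (auto simp: qball_def)
  qed
  have tri: "d x y < \<kappa> * (a + b)" if "d x z < a" "d z y < b" for x y z a b
    using \<kappa> that by (smt (verit) mult_less_cancel_left_pos)
  \<comment> \<open>Any section of \<open>K\<close> below lies in the ball of radius \<open>8 * \<kappa> ^ 3 * r\<close> around each of its points:
    pairs in \<open>K\<close> have distance less than \<open>4 * \<kappa>\<^sup>2 * r\<close>, and one more triangle inequality compares two
    points of the same section.\<close>
  obtain n where n: "8 * \<kappa> ^ 3 < 2 ^ n"
    using real_arch_pow[of 2 "8 * \<kappa> ^ 3"] by auto
  define c where "c = C ^ n"
  have "0 < c" using C by (simp add: c_def)
  show ?thesis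
  proof (intro exI[of _ c] conjI allI impI \<open>0 < c\<close>)
    fix r :: real assume "0 < r"
    \<comment> \<open>The radius \<open>2 * \<kappa> * r\<close> is large enough for one square to contain both points of a pair at distance
      less than \<open>r\<close>, once its centre is within \<open>r\<close> of the first point.\<close>
    define K where "K = (\<Union>z\<in>D. qball d z (2 * \<kappa> * r) \<times> qball d z (2 * \<kappa> * r))"
    have [measurable]: "K \<in> sets (M \<Otimes>\<^sub>M M)"
      unfolding K_def using D by (intro sets.countable_UN') auto
    define u where "u x = emeasure M ((\<lambda>y. (y, x)) -` K)" for x
    have [measurable]: "u \<in> borel_measurable M"
      unfolding u_def by (rule measurable_emeasure_Pair2) measurable
    have sec [measurable]: "(\<lambda>y. (y, x)) -` K \<in> sets M" for x
      by (rule sets_Pair2) measurable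
    have inK: "(y, x) \<in> K" if "d y x < r" for y x
    proof -
      obtain z where z: "z \<in> D" "d y z < r" using dense[OF \<open>0 < r\<close>] by blast
      have "d z y < 2 * \<kappa> * r"
        using z sym[of y z] \<kappa>(1) \<open>0 < r\<close> by (smt (verit) mult_le_cancel_right1)
      moreover have "d z x < 2 * \<kappa> * r"
        using tri[of z y r x r] z that sym[of y z] by (simp add: algebra_simps)
      ultimately show ?thesis using z by (auto simp: K_def qball_def)
    qed
    have Kd: "d y x < 4 * \<kappa>\<^sup>2 * r" if yx: "(y, x) \<in> K" for y x
    proof -
      obtain z where "d z y < 2 * \<kappa> * r" "d z x < 2 * \<kappa> * r"
        using yx by (auto simp: K_def qball_def)
      then have "d y x < \<kappa> * (2 * \<kappa> * r + 2 * \<kappa> * r)"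
        using tri[of y z "2 * \<kappa> * r" x "2 * \<kappa> * r"] sym[of y z] by simp
      then show ?thesis by (simp add: power2_eq_square algebra_simps)
    qed
    have u_le: "u x \<le> ennreal c * emeasure M (qball d y r)" if "(y, x) \<in> K" for y x
    proof -
      have "(\<lambda>y. (y, x)) -` K \<subseteq> qball d y (2 ^ n * r)"
      proof
        fix y' assume "y' \<in> (\<lambda>y. (y, x)) -` K"
        then have "d x y' < 4 * \<kappa>\<^sup>2 * r" using Kd[of y' x] sym[of x y'] by simp
        then have "d y y' < \<kappa> * (4 * \<kappa>\<^sup>2 * r + 4 * \<kappa>\<^sup>2 * r)"
          using tri Kd[OF that] by blast
        also have "\<dots> = 8 * \<kappa> ^ 3 * r" by (simp add: power2_eq_square power3_eq_cube)
        also have "\<dots> < 2 ^ n * r" using n \<open>0 < r\<close> by simp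
        finally show "y' \<in> qball d y (2 ^ n * r)" by (simp add: qball_def)
      qed
      then have "u x \<le> emeasure M (qball d y (2 ^ n * r))"
        unfolding u_def by (intro emeasure_mono) auto
      also have "\<dots> \<le> ennreal c * emeasure M (qball d y r)"
        unfolding c_def by (rule C(2)[OF \<open>0 < r\<close>])
      finally show ?thesis .
    qed
    have u_pos: "0 < u x" for x
    proof -
      have "qball d x r \<subseteq> (\<lambda>y. (y, x)) -` K"
        using inK sym by (auto simp: qball_def)
      then have "emeasure M (qball d x r) \<le> u x" unfolding u_def by (intro emeasure_mono) auto
      then show ?thesis using emeasure_qball_pos[OF \<open>0 < r\<close>, of x] by (rule less_le_trans[rotated])
    qed
    have u_fin: "u x < top" for x
    proof -
      have "u x \<le> ennreal c * emeasure M (qball d x r)"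
        using zero_iff[of x x] \<open>0 < r\<close> by (intro u_le inK) simp
      also have "\<dots> < top"
        using emeasure_qball_finite[OF \<open>0 < r\<close>] by (simp add: ennreal_mult_less_top)
      finally show ?thesis .
    qed
    define k where "k y x = ennreal c / u x * indicator K (y, x)" for y x
    show "\<exists>k. case_prod k \<in> borel_measurable (M \<Otimes>\<^sub>M M) \<and>
     (\<forall>y x. d y x < r \<longrightarrow> ennreal (1 / measure M (qball d y r)) \<le> k y x) \<and>
     (\<forall>x. (\<integral>\<^sup>+y. k y x \<partial>M) \<le> ennreal c)"
    proof (intro exI[of _ k] conjI allI impI)
      show "case_prod k \<in> borel_measurable (M \<Otimes>\<^sub>M M)"
        unfolding k_def by measurable
      fix x
      show "ennreal (1 / measure M (qball d y r)) \<le> k y x" if "d y x < r" for y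
      proof -
        obtain s where s: "u x = ennreal s" "0 < s"
          using u_pos[of x] u_fin[of x] by (cases "u x") auto
        define v where "v = measure M (qball d y r)"
        have "0 < v" unfolding v_def by (rule measure_qball_pos) fact
        have "ennreal s \<le> ennreal (c * v)"
          using u_le[OF inK[OF that]] emeasure_qball[OF \<open>0 < r\<close>] s \<open>0 < c\<close>
          by (simp add: v_def ennreal_mult')
        then have "s \<le> c * v"
          using \<open>0 < c\<close> \<open>0 < v\<close> by (subst (asm) ennreal_le_iff) auto
        then have "1 / v \<le> c / s"
          using \<open>0 < v\<close> s by (simp add: field_simps)
        then have "ennreal (1 / v) \<le> ennreal c / ennreal s"
          using s \<open>0 < c\<close> by (simp add: divide_ennreal)
        then show ?thesis
          using inK[OF that] s by (simp add: k_def v_def)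
      qed
      have "(\<integral>\<^sup>+y. k y x \<partial>M) = (\<integral>\<^sup>+y. ennreal c / u x * indicator ((\<lambda>y. (y, x)) -` K) y \<partial>M)"
        unfolding k_def by (intro nn_integral_cong) (auto simp: indicator_def)
      also have "\<dots> = ennreal c / u x * u x"
        unfolding u_def by (rule nn_integral_cmult_indicator) measurable
      also have "\<dots> = ennreal c"
        using u_pos[of x] u_fin[of x] by (simp add: ennreal_divide_times ennreal_divide_self)
      finally show "(\<integral>\<^sup>+y. k y x \<partial>M) \<le> ennreal c" by simp
    qed
  qed
qed

lemma (in homogeneous_type_space) sets_superlevel:
  fixes h :: "'a \<Rightarrow> real"
  assumes [measurable]: "h \<in> borel_measurable M"
  shows "{x. l < h x} \<in> sets M"
proof -
  have "{x \<in> space M. l < h x} \<in> sets M" by measurable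
  then show ?thesis by (simp add: space_M)
qed

text \<open>
  Split \<open>\<mu>(B \<inter> E\<^sub>l)\<^bsup>a\<^esup>\<close> into \<open>\<mu>(B \<inter> E\<^sub>l)\<^bsup>a-1\<^esup>\<close>, bounded by the global \<open>\<mu>(E\<^sub>l)\<^bsup>a-1\<^esup>\<close>, and one factor
  \<open>\<mu>(B \<inter> E\<^sub>l)\<close>, which stays local: divided by the measure of the ball it is at most the integral of the
  kernel over \<open>E\<^sub>l\<close>, and averaging over \<open>y\<close> turns it into at most \<open>c \<mu>(E\<^sub>l)\<close>.  The measurable majorant
  \<open>G\<close> avoids a discussion of how the left-hand side depends on the centre \<open>y\<close>; constants can be taken
  out of the integral of \<open>G\<close>.
\<close>

lemma (in homogeneous_type_space) averaged_levels_le: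
  assumes [measurable]: "case_prod k \<in> borel_measurable (M \<Otimes>\<^sub>M M)"
    and k1: "\<And>y x. d y x < r \<Longrightarrow> ennreal (1 / measure M (qball d y r)) \<le> k y x"
    and k2: "\<And>x. (\<integral>\<^sup>+y. k y x \<partial>M) \<le> ennreal c"
    and [measurable]: "h \<in> borel_measurable M" and "1 \<le> a"
  shows "\<exists>G\<in>borel_measurable M.
    (\<forall>y. ennreal (1 / measure M (qball d y r)) *
       (\<integral>\<^sup>+l\<in>{0<..}. ennreal (p * l powr (p - 1)) * epowr (emeasure M {x\<in>qball d y r. l < h x}) a \<partial>lborel) \<le> G y) \<and>
    (\<integral>\<^sup>+y. G y \<partial>M) \<le> ennreal c * (\<integral>\<^sup>+l\<in>{0<..}. ennreal (p * l powr (p - 1)) * epowr (emeasure M {x. l < h x}) a \<partial>lborel)"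
proof -
  interpret sigma_finite_measure M by (rule sigma_finite)
  interpret P: pair_sigma_finite lborel M ..
  interpret Q: pair_sigma_finite M M ..
  note sets_superlevel[OF \<open>h \<in> borel_measurable M\<close>, measurable]
  define D where "D l = emeasure M {x. l < h x}" for l
  have [measurable]: "D \<in> borel_measurable borel"
    unfolding D_def by (intro borel_measurable_antimono_ennreal antimonoI emeasure_mono) auto
  define F where "F l = ennreal (p * l powr (p - 1)) * indicator {0<..} l * epowr (D l) (a - 1)" for l
  have [measurable]: "F \<in> borel_measurable borel" unfolding F_def by measurable
  define n where "n l y = (\<integral>\<^sup>+x. indicator {x. l < h x} x * k y x \<partial>M)" for l y
  have [measurable]: "case_prod n \<in> borel_measurable (lborel \<Otimes>\<^sub>M M)"
    unfolding n_def by measurable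
  have D_pow: "epowr (D l) (a - 1) * D l = epowr (D l) a" for l
    using epowr_add[of "D l" "a - 1" 1] by simp
  show ?thesis
  proof (intro bexI[of _ "\<lambda>y. \<integral>\<^sup>+l. F l * n l y \<partial>lborel"] conjI allI)
    show "(\<lambda>y. \<integral>\<^sup>+l. F l * n l y \<partial>lborel) \<in> borel_measurable M" by measurable
  next
    fix y
    define v where "v = measure M (qball d y r)"
    define m where "m l = emeasure M {x\<in>qball d y r. l < h x}" for l
    have level_ball [measurable]: "{x\<in>qball d y r. l < h x} \<in> sets M" for l
    proof -
      have "qball d y r \<inter> {x. l < h x} \<in> sets M" by measurable
      then show ?thesis by (simp add: Int_def)
    qed
    have [measurable]: "m \<in> borel_measurable borel"
      unfolding m_def by (intro borel_measurable_antimono_ennreal antimonoI emeasure_mono level_ball) auto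
    have mn: "ennreal (1 / v) * m l \<le> n l y" for l
    proof -
      have "ennreal (1 / v) * m l = (\<integral>\<^sup>+x. ennreal (1 / v) * indicator {x\<in>qball d y r. l < h x} x \<partial>M)"
        unfolding m_def by (rule nn_integral_cmult_indicator[symmetric]) measurable
      also have "\<dots> \<le> n l y"
        unfolding n_def using k1[of y]
        by (intro nn_integral_mono) (auto simp: indicator_def qball_def v_def)
      finally show ?thesis .
    qed
    have "ennreal (1 / v) * (\<integral>\<^sup>+l\<in>{0<..}. ennreal (p * l powr (p - 1)) * epowr (m l) a \<partial>lborel)
      = (\<integral>\<^sup>+l. ennreal (1 / v) * (ennreal (p * l powr (p - 1)) * epowr (m l) a * indicator {0<..} l) \<partial>lborel)"
      by (rule nn_integral_cmult[symmetric]) measurable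
    also have "\<dots> \<le> (\<integral>\<^sup>+l. F l * n l y \<partial>lborel)"
    proof (intro nn_integral_mono)
      fix l
      have "m l \<le> D l" unfolding m_def D_def by (intro emeasure_mono) auto
      then have "epowr (m l) (a - 1) \<le> epowr (D l) (a - 1)"
        using \<open>1 \<le> a\<close> by (intro epowr_mono) auto
      then have "epowr (m l) (a - 1) * (ennreal (1 / v) * m l) \<le> epowr (D l) (a - 1) * n l y"
        using mn by (rule mult_mono) auto
      moreover have "epowr (m l) a = epowr (m l) (a - 1) * m l"
        using epowr_add[of "m l" "a - 1" 1] by simp
      ultimately have "ennreal (1 / v) * epowr (m l) a \<le> epowr (D l) (a - 1) * n l y"
        by (simp add: mult_ac)
      then have "ennreal (p * l powr (p - 1)) * indicator {0<..} l * (ennreal (1 / v) * epowr (m l) a)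
        \<le> ennreal (p * l powr (p - 1)) * indicator {0<..} l * (epowr (D l) (a - 1) * n l y)"
        by (rule mult_left_mono) simp
      then show "ennreal (1 / v) * (ennreal (p * l powr (p - 1)) * epowr (m l) a * indicator {0<..} l) \<le> F l * n l y"
        unfolding F_def by (simp add: mult_ac)
    qed
    finally show "ennreal (1 / measure M (qball d y r)) *
       (\<integral>\<^sup>+l\<in>{0<..}. ennreal (p * l powr (p - 1)) * epowr (emeasure M {x\<in>qball d y r. l < h x}) a \<partial>lborel)
       \<le> (\<integral>\<^sup>+l. F l * n l y \<partial>lborel)"
      unfolding m_def v_def .
  next
    have n_le: "(\<integral>\<^sup>+y. n l y \<partial>M) \<le> ennreal c * D l" for l
    proof -
      have "(\<integral>\<^sup>+y. n l y \<partial>M) = (\<integral>\<^sup>+x. \<integral>\<^sup>+y. indicator {x. l < h x} x * k y x \<partial>M \<partial>M)"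
        unfolding n_def by (rule Q.Fubini'[symmetric]) measurable
      also have "\<dots> = (\<integral>\<^sup>+x. indicator {x. l < h x} x * (\<integral>\<^sup>+y. k y x \<partial>M) \<partial>M)"
        by (intro nn_integral_cong nn_integral_cmult) measurable
      also have "\<dots> \<le> (\<integral>\<^sup>+x. ennreal c * indicator {x. l < h x} x \<partial>M)"
        using k2 by (intro nn_integral_mono) (auto simp: indicator_def)
      also have "\<dots> = ennreal c * D l"
        unfolding D_def by (rule nn_integral_cmult_indicator) measurable
      finally show ?thesis .
    qed
    have "(\<integral>\<^sup>+y. \<integral>\<^sup>+l. F l * n l y \<partial>lborel \<partial>M) = (\<integral>\<^sup>+l. \<integral>\<^sup>+y. F l * n l y \<partial>M \<partial>lborel)"
      by (rule P.Fubini') measurable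
    also have "\<dots> = (\<integral>\<^sup>+l. F l * (\<integral>\<^sup>+y. n l y \<partial>M) \<partial>lborel)"
      by (intro nn_integral_cong nn_integral_cmult) measurable
    also have "\<dots> \<le> (\<integral>\<^sup>+l. F l * (ennreal c * D l) \<partial>lborel)"
      by (intro nn_integral_mono mult_left_mono n_le) simp
    also have "\<dots> = (\<integral>\<^sup>+l. ennreal c * (ennreal (p * l powr (p - 1)) * epowr (D l) a * indicator {0<..} l) \<partial>lborel)"
      unfolding F_def D_pow[symmetric] by (simp add: mult_ac)
    also have "\<dots> = ennreal c * (\<integral>\<^sup>+l\<in>{0<..}. ennreal (p * l powr (p - 1)) * epowr (D l) a \<partial>lborel)"
      by (rule nn_integral_cmult) measurable
    finally show "(\<integral>\<^sup>+y. \<integral>\<^sup>+l. F l * n l y \<partial>lborel \<partial>M)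
      \<le> ennreal c * (\<integral>\<^sup>+l\<in>{0<..}. ennreal (p * l powr (p - 1)) * epowr (emeasure M {x. l < h x}) a \<partial>lborel)"
      unfolding D_def .
  qed
qed

section \<open>Comparison of the amalgam and Lorentz norms\<close>

text \<open>
  Both norms depend only on \<open>norm \<circ> f\<close> up to null sets.  Replacing it by a function measurable for \<open>M\<close>
  itself makes product measurability, and hence Tonelli, available.
\<close>

lemma completion_norm_representative:
  fixes f :: "'a \<Rightarrow> complex"
  assumes f [measurable]: "f \<in> borel_measurable (completion M)"
  obtains h where "h \<in> borel_measurable M" "\<And>x. 0 \<le> h x"
    "\<And>l. distribution_fun (completion M) f l = emeasure M {x\<in>space M. l < h x}"
    "\<And>B q. 0 < q \<Longrightarrow> Lq_norm (completion M) q (\<lambda>x. f x * indicator B x)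
       = epowr (\<integral>\<^sup>+x\<in>B. ennreal (h x powr q) \<partial>M) (1 / q)"
proof -
  have "(\<lambda>x. norm (f x)) \<in> borel_measurable (completion M)" by measurable
  then obtain g where g [measurable]: "g \<in> borel_measurable M" and fg: "AE x in M. norm (f x) = g x"
    using completion_ex_borel_measurable_real by blast
  define h where "h x = max 0 (g x)" for x
  have [measurable]: "h \<in> borel_measurable M" unfolding h_def by measurable
  have fh: "AE x in M. norm (f x) = h x"
    using fg by eventually_elim (metis h_def max.absorb2 norm_ge_zero)
  show thesis
  proof
    show "h \<in> borel_measurable M" "0 \<le> h x" for x
      by (simp_all add: h_def)
    show "distribution_fun (completion M) f l = emeasure M {x\<in>space M. l < h x}" for l
    proof -
      have sets: "{x\<in>space M. l < h x} \<in> sets M" by measurable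
      have "{x \<in> space (completion M). l < norm (f x)} \<in> sets (completion M)" by measurable
      then have "distribution_fun (completion M) f l = emeasure (completion M) {x\<in>space M. l < h x}"
        unfolding distribution_fun_def using AE_completion[OF fh] sets
        by (intro emeasure_eq_AE) auto
      then show ?thesis using sets by simp
    qed
    show "Lq_norm (completion M) q (\<lambda>x. f x * indicator B x)
       = epowr (\<integral>\<^sup>+x\<in>B. ennreal (h x powr q) \<partial>M) (1 / q)" if "0 < q" for B q
    proof -
      have "(\<integral>\<^sup>+x. ennreal (norm (f x * indicator B x) powr q) \<partial>M) = (\<integral>\<^sup>+x\<in>B. ennreal (h x powr q) \<partial>M)"
        using fh by (intro nn_integral_cong_AE) (auto elim!: eventually_mono simp: indicator_def)
      then show ?thesis by (simp add: Lq_norm_def nn_integral_completion)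
    qed
  qed
qed

lemma (in homogeneous_type_space) amalgam_norm_le_lorentz_norm_infinity:
  fixes f :: "'a \<Rightarrow> complex"
  assumes "0 < q" "q < \<alpha>" and f: "f \<in> borel_measurable (completion M)"
  shows "amalgam_norm d (completion M) q \<infinity> \<alpha> f
    \<le> ennreal ((\<alpha> / (\<alpha> - q)) powr (1 / q)) * lorentz_norm (completion M) \<alpha> \<infinity> f"
proof (cases "lorentz_norm (completion M) \<alpha> \<infinity> f")
  case top
  then show ?thesis using assms by (simp add: ennreal_mult_top)
next
  case (real S)
  obtain h where h: "h \<in> borel_measurable M" "\<And>x. 0 \<le> h x"
    "\<And>l. distribution_fun (completion M) f l = emeasure M {x\<in>space M. l < h x}"
    "\<And>B q. 0 < q \<Longrightarrow> Lq_norm (completion M) q (\<lambda>x. f x * indicator B x)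
       = epowr (\<integral>\<^sup>+x\<in>B. ennreal (h x powr q) \<partial>M) (1 / q)"
    by (rule completion_norm_representative[OF f]) (use that in blast)
  have "ennreal (measure (completion M) (qball d y r) powr (1 / \<alpha> - 1 / q)) *
      Lq_norm (completion M) q (\<lambda>x. f x * indicator (qball d y r) x)
      \<le> ennreal ((\<alpha> / (\<alpha> - q)) powr (1 / q)) * ennreal S" if "0 < r" for y r
  proof -
    have "emeasure M {x\<in>qball d y r. l < h x} \<le> ennreal (S powr \<alpha> * l powr (- \<alpha>))" if "0 < l" for l
    proof -
      have "emeasure M {x\<in>qball d y r. l < h x} \<le> emeasure M {x\<in>space M. l < h x}"
        using sets_superlevel[OF h(1)] by (intro emeasure_mono) (auto simp: space_M)
      also have "\<dots> \<le> ennreal (S powr \<alpha> * l powr (- \<alpha>))"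
        using distribution_fun_le_lorentz_norm_infinity[OF f _ that] real assms h(3) by simp
      finally show ?thesis .
    qed
    then have "ennreal (measure M (qball d y r) powr (1 / \<alpha> - 1 / q)) *
        epowr (\<integral>\<^sup>+x\<in>qball d y r. ennreal (h x powr q) \<partial>M) (1 / q)
      \<le> ennreal ((\<alpha> / (\<alpha> - q)) powr (1 / q) * (S powr \<alpha>) powr (1 / \<alpha>))"
      using assms h sigma_finite emeasure_qball[OF \<open>0 < r\<close>] measure_qball_pos[OF \<open>0 < r\<close>]
      by (intro scaled_average_le_weak) auto
    then show ?thesis
      using assms real h(4) by (simp add: powr_powr ennreal_mult)
  qed
  then show ?thesis
    unfolding amalgam_norm_def amalgam_norm_at_def using real by (auto intro!: SUP_least)
qed

lemma (in homogeneous_type_space) amalgam_norm_le_lorentz_norm_finite: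
  assumes q: "0 < q" "q < \<alpha>" "\<alpha> < p"
  shows "\<exists>C>0::real. \<forall>f :: 'a \<Rightarrow> complex. f \<in> borel_measurable (completion M) \<longrightarrow>
    amalgam_norm d (completion M) q (ereal p) \<alpha> f \<le> ennreal C * lorentz_norm (completion M) \<alpha> (ereal p) f"
proof -
  obtain c where "0 < c" and kernel: "\<And>r. 0 < r \<Longrightarrow> \<exists>k. case_prod k \<in> borel_measurable (M \<Otimes>\<^sub>M M) \<and>
     (\<forall>y x. d y x < r \<longrightarrow> ennreal (1 / measure M (qball d y r)) \<le> k y x) \<and>
     (\<forall>x. (\<integral>\<^sup>+y. k y x \<partial>M) \<le> ennreal c)"
    using averaging_kernel by blast
  define b where "b = (\<alpha> / (\<alpha> - q)) powr (p / q)"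
  have "0 < b" using q by (simp add: b_def)
  \<comment> \<open>The factors come from the local estimate, the kernel and the comparison of levels with the
    rearrangement; the \<open>p\<close>-th root is taken at the end.\<close>
  define C where "C = b * (c * (p / \<alpha>)\<^sup>2)"
  have "0 < C" using \<open>0 < b\<close> \<open>0 < c\<close> q by (simp add: C_def)
  have "amalgam_norm d (completion M) q (ereal p) \<alpha> f
      \<le> ennreal (C powr (1 / p)) * lorentz_norm (completion M) \<alpha> (ereal p) f"
    if f: "f \<in> borel_measurable (completion M)" for f :: "'a \<Rightarrow> complex"
    unfolding amalgam_norm_def
  proof (rule SUP_least)
    fix r :: real assume "r \<in> {0<..}"
    then have "0 < r" by simp
    obtain k where k: "case_prod k \<in> borel_measurable (M \<Otimes>\<^sub>M M)"
      "\<And>y x. d y x < r \<Longrightarrow> ennreal (1 / measure M (qball d y r)) \<le> k y x"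
      "\<And>x. (\<integral>\<^sup>+y. k y x \<partial>M) \<le> ennreal c"
      using kernel[OF \<open>0 < r\<close>] by blast
    obtain h where h: "h \<in> borel_measurable M" "\<And>x. 0 \<le> h x"
      "\<And>l. distribution_fun (completion M) f l = emeasure M {x\<in>space M. l < h x}"
      "\<And>B q. 0 < q \<Longrightarrow> Lq_norm (completion M) q (\<lambda>x. f x * indicator B x)
         = epowr (\<integral>\<^sup>+x\<in>B. ennreal (h x powr q) \<partial>M) (1 / q)"
      by (rule completion_norm_representative[OF f]) (use that in blast)
    define L where "L = epowr (lorentz_norm (completion M) \<alpha> (ereal p) f) p"
    define v where "v y = measure M (qball d y r)" for y
    define A where "A y = (\<integral>\<^sup>+l\<in>{0<..}. ennreal (p * l powr (p - 1)) *
      epowr (emeasure M {x\<in>qball d y r. l < h x}) (p / \<alpha>) \<partial>lborel)" for y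
    obtain G where G: "G \<in> borel_measurable M" "\<And>y. ennreal (1 / v y) * A y \<le> G y"
      "(\<integral>\<^sup>+y. G y \<partial>M) \<le> ennreal c * (\<integral>\<^sup>+l\<in>{0<..}. ennreal (p * l powr (p - 1)) *
          epowr (emeasure M {x. l < h x}) (p / \<alpha>) \<partial>lborel)"
      unfolding A_def v_def
      using averaged_levels_le[OF k h(1), of "p / \<alpha>" p] q by auto
    have "(\<integral>\<^sup>+y. G y \<partial>M) \<le> ennreal c * (ennreal ((p / \<alpha>)\<^sup>2) * L)"
    proof (rule order_trans[OF G(3)], rule mult_left_mono)
      show "(\<integral>\<^sup>+l\<in>{0<..}. ennreal (p * l powr (p - 1)) * epowr (emeasure M {x. l < h x}) (p / \<alpha>) \<partial>lborel)
        \<le> ennreal ((p / \<alpha>)\<^sup>2) * L"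
        using nn_integral_levels_le_lorentz_norm[OF f, of \<alpha> p] q by (simp add: h(3) space_M L_def)
    qed simp
    then have G_le: "ennreal b * (\<integral>\<^sup>+y. G y \<partial>M) \<le> ennreal C * L"
      using \<open>0 < b\<close> \<open>0 < c\<close>
      by (auto simp: C_def ennreal_mult mult.assoc intro!: mult_left_mono)
    have "(\<integral>\<^sup>+y. epowr (ennreal (measure (completion M) (qball d y r) powr (1 / \<alpha> - 1 / p - 1 / q)) *
           Lq_norm (completion M) q (\<lambda>x. f x * indicator (qball d y r) x)) p \<partial>completion M)
      \<le> (\<integral>\<^sup>+y. ennreal b * G y \<partial>M)"
      unfolding nn_integral_completion
    proof (rule nn_integral_mono)
      fix y
      have "epowr (ennreal (v y powr (1 / \<alpha> - 1 / p - 1 / q)) *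
          epowr (\<integral>\<^sup>+x\<in>qball d y r. ennreal (h x powr q) \<partial>M) (1 / q)) p
        \<le> ennreal b * (ennreal (1 / v y) * A y)"
        unfolding b_def A_def v_def
        using h q sigma_finite emeasure_qball[OF \<open>0 < r\<close>] measure_qball_pos[OF \<open>0 < r\<close>]
        by (intro scaled_average_le_levels) auto
      also have "\<dots> \<le> ennreal b * G y"
        by (intro mult_left_mono G) simp
      finally show "epowr (ennreal (measure (completion M) (qball d y r) powr (1 / \<alpha> - 1 / p - 1 / q)) *
           Lq_norm (completion M) q (\<lambda>x. f x * indicator (qball d y r) x)) p \<le> ennreal b * G y"
        using q h(4) by (simp add: v_def)
    qed
    also have "\<dots> = ennreal b * (\<integral>\<^sup>+y. G y \<partial>M)"
      using G(1) by (rule nn_integral_cmult)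
    also note G_le
    finally have "amalgam_norm_at d (completion M) r q (ereal p) \<alpha> f \<le> epowr (ennreal C * L) (1 / p)"
      unfolding amalgam_norm_at_def using q by (auto intro!: epowr_mono)
    also have "\<dots> = ennreal (C powr (1 / p)) * lorentz_norm (completion M) \<alpha> (ereal p) f"
      using \<open>0 < C\<close> q by (simp add: epowr_cmult epowr_epowr L_def)
    finally show "amalgam_norm_at d (completion M) r q (ereal p) \<alpha> f
      \<le> ennreal (C powr (1 / p)) * lorentz_norm (completion M) \<alpha> (ereal p) f" .
  qed
  then show ?thesis using \<open>0 < C\<close> by (intro exI[of _ "C powr (1 / p)"]) auto
qed

theorem theorem2p10:
  fixes d :: "'a \<Rightarrow> 'a \<Rightarrow> real" and \<mu> :: "'a measure"
    and q \<alpha> :: real and p :: ereal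
  assumes "homogeneous_type_space d \<mu>"
    and "1 \<le> q" and "q < \<alpha>" and "ereal \<alpha> < p"
  shows "\<exists>C::real. C > 0 \<and>
    (\<forall>f :: 'a \<Rightarrow> complex. f \<in> borel_measurable (completion \<mu>) \<longrightarrow>
       amalgam_norm d (completion \<mu>) q p \<alpha> f \<le> ennreal C * lorentz_norm (completion \<mu>) \<alpha> p f)"
proof -
  interpret homogeneous_type_space d \<mu> by fact
  have "0 < q" using assms by simp
  show ?thesis
  proof (cases p)
    case (real p')
    then show ?thesis
      using amalgam_norm_le_lorentz_norm_finite[OF \<open>0 < q\<close> \<open>q < \<alpha>\<close>, of p'] assms by simp
  next
    case PInf
    have "0 < (\<alpha> / (\<alpha> - q)) powr (1 / q)"
      using \<open>0 < q\<close> \<open>q < \<alpha>\<close> by simp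
    with PInf show ?thesis
      using amalgam_norm_le_lorentz_norm_infinity[OF \<open>0 < q\<close> \<open>q < \<alpha>\<close>] by blast
  qed (use assms in simp)
qed

end
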